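(* Let $k \geq 2$ be an integer, and let $G$ be a (finite) $k$-tree. Then $\mathrm{col}_{cg}(G) \leq 3k$. Furthermore, if $k = 2$, then $\mathrm{col}_{cg}(G) \leq 5$.
   Context: All graphs are finite. A $k$-tree is a graph that may be constructed by starting with a copy of the complete graph $K_k$ and then iteratively adding new vertices of degree $k$ (at the time of addition) whose $k$ neighbors induce a $K_k$. Connected marking game. In the connected marking game on a connected graph $G$, two players, Alice and Bob, take turns marking unmarked vertices of $G$ one at a time, with Alice marking first, until all vertices are marked; both players must play so that the set of marked vertices always induces a connected subgraph of $G$ (so every move after the first marks a vertex adjacent to an already marked vertex). Each vertex $v$ receives a score equal to the number of neighbors of $v$ marked before $v$, and the score of the play is the maximum score of a vertex. The connected game coloring number $\mathrm{col}_{cg}(G)$ is the minimum integer $m$ for which Alice has a strategy guaranteeing that, at each game state, every unmarked vertex has at most $m-1$ marked neighbors; equivalently, $\mathrm{col}_{cg}(G)-1$ is the minimum play score that Alice can guarantee. *)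

theory Defs
  imports "Graph_Theory.Kuratowski"
begin

text \<open>
  A finite simple graph is a symmetric loop-free digraph without multiple arcs
  (\<^locale>\<open>pair_graph\<close>): the edge \<open>uv\<close> is the pair of arcs \<open>(u, v)\<close>, \<open>(v, u)\<close>.
\<close>

inductive k_tree :: "nat \<Rightarrow> 'a pair_pre_digraph \<Rightarrow> bool" for k :: nat where
  complete: "K\<^bsub>k\<^esub> (with_proj G) \<Longrightarrow> k_tree k G"
| add_vertex: "\<lbrakk>k_tree k G; v \<notin> pverts G; S \<subseteq> pverts G; K\<^bsub>k\<^esub> (with_proj G \<restriction> S)\<rbrakk> \<Longrightarrow>
    k_tree k \<lparr>pverts = insert v (pverts G), parcs = parcs G \<union> {v} \<times> S \<union> S \<times> {v}\<rparr>"

lemma k_tree_imp_pair_graph: "k_tree k G \<Longrightarrow> pair_graph G"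
proof (induction rule: k_tree.induct)
  case (complete G)
  then show ?case by (rule pair_graphI_complete)
next
  case (add_vertex G v S)
  interpret pair_graph G by (rule add_vertex.IH)
  have "finite S" using add_vertex.hyps pair_finite_verts by (meson finite_subset)
  moreover have "sym (parcs G)" using pair_sym_arcs by (simp add: symmetric_def)
  ultimately show ?case
    using add_vertex.hyps pair_finite_verts pair_finite_arcs
    by unfold_locales
      (auto simp: symmetric_def sym_def dest: arc_fst_in_verts arc_snd_in_verts pair_no_loops)
qed

definition legal_move :: "'a pair_pre_digraph \<Rightarrow> 'a set \<Rightarrow> 'a \<Rightarrow> bool" where
  "legal_move G M v \<longleftrightarrow> v \<in> pverts G \<and> v \<notin> M
     \<and> Digraph_Component.connected (with_proj G \<restriction> insert v M)"

text \<open>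
  A game state is the list of the marked vertices in the order of their marking. Alice
  moves first, so it is her turn exactly when the length of the list is even.
\<close>

definition legal_play :: "'a pair_pre_digraph \<Rightarrow> 'a list \<Rightarrow> bool" where
  "legal_play G p \<longleftrightarrow> (\<forall>i<length p. legal_move G (set (take i p)) (p ! i))"

definition follows :: "('a list \<Rightarrow> 'a) \<Rightarrow> 'a list \<Rightarrow> bool" where
  "follows \<sigma> p \<longleftrightarrow> (\<forall>i<length p. even i \<longrightarrow> p ! i = \<sigma> (take i p))"

definition alice_strategy :: "'a pair_pre_digraph \<Rightarrow> ('a list \<Rightarrow> 'a) \<Rightarrow> bool" where
  "alice_strategy G \<sigma> \<longleftrightarrow>
     (\<forall>p. legal_play G p \<and> follows \<sigma> p \<and> even (length p) \<and> set p \<noteq> pverts G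
          \<longrightarrow> legal_move G (set p) (\<sigma> p))"

definition marked_neighbors :: "'a pair_pre_digraph \<Rightarrow> 'a set \<Rightarrow> 'a \<Rightarrow> 'a set" where
  "marked_neighbors G M v = {u \<in> M. v \<rightarrow>\<^bsub>with_proj G\<^esub> u}"

text \<open>The bound ``at most \<open>m - 1\<close>'' is written \<open>< m\<close>, as subtraction on naturals truncates.\<close>

definition guarantees :: "'a pair_pre_digraph \<Rightarrow> ('a list \<Rightarrow> 'a) \<Rightarrow> nat \<Rightarrow> bool" where
  "guarantees G \<sigma> m \<longleftrightarrow>
     (\<forall>p. legal_play G p \<and> follows \<sigma> p
          \<longrightarrow> (\<forall>v \<in> pverts G - set p. card (marked_neighbors G (set p) v) < m))"

text \<open>
  Meaningful for finite connected graphs, where every legal play can be continued until all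
  vertices are marked; the set of admissible \<open>m\<close> is then nonempty.
\<close>

definition col_cg :: "'a pair_pre_digraph \<Rightarrow> nat" where
  "col_cg G = (LEAST m. \<exists>\<sigma>. alice_strategy G \<sigma> \<and> guarantees G \<sigma> m)"

end

theory Submission
  imports Defs
begin

text \<open>
  Order the vertices by the construction of the \<open>k\<close>-tree; the parents of a vertex are its
  earlier neighbors, at most \<open>k\<close> of them and pairwise adjacent. Alice starts with the first
  vertex and then plays the activation strategy: a newly active vertex (the one Bob has just
  marked, to begin with) hits its least unmarked parent \<open>w\<close>. If \<open>w\<close> is already active, Alice
  marks it; otherwise \<open>w\<close> becomes active and hits in turn. An active vertex without unmarked
  parents is marked.

  Every active child of an unmarked vertex \<open>u\<close> has hit \<open>u\<close> or a parent of \<open>u\<close>. An unmarked vertex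
  has been hit at most once after a move of Alice, and every vertex at most twice. Because
  the marked set is connected, some parent of \<open>u\<close> is marked before any child of \<open>u\<close> becomes
  active, so only \<open>k - 1\<close> parents are ever hit by children of \<open>u\<close>; and if \<open>u\<close> has been hit
  itself, it has spent one hit on those parents. Hence \<open>u\<close> has at most \<open>2(k - 1)\<close> active
  children, and after Bob's move at most \<open>k + 2(k - 1) + 1 = 3k - 1\<close> marked neighbors. For
  \<open>k = 2\<close> an active child of \<open>u\<close> has a marked parent, hence can only have hit \<open>u\<close>, which leaves
  at most \<open>2 + 1 + 1\<close> marked neighbors.
\<close>

section \<open>The activation invariant\<close>

locale parent_order =
  fixes V :: "'a set" and P :: "'a \<Rightarrow> 'a set" and r :: "'a \<Rightarrow> nat" and root :: 'a and k :: nat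
  assumes finite_V: "finite V"
    and parents: "u \<in> P v \<Longrightarrow> u \<in> V \<and> v \<in> V \<and> r u < r v"
    and clique: "a \<in> P v \<Longrightarrow> b \<in> P v \<Longrightarrow> a \<noteq> b \<Longrightarrow> a \<in> P b \<or> b \<in> P a"
    and card_parents: "card (P v) \<le> k"
    and no_parents_iff: "v \<in> V \<and> P v = {} \<longleftrightarrow> v = root"
begin

lemma root_in_V: "root \<in> V" and parents_root: "P root = {}"
  using no_parents_iff by auto

lemma finite_parents: "finite (P v)"
  using parents by (meson finite_V finite_subset subsetI)

text \<open>\<open>M\<close> is the set of marked vertices, \<open>A\<close> the set of active ones, and \<open>H\<close> the set of those
  active vertices \<open>c\<close> that have already hit a parent, namely \<open>h c\<close>. The vertex \<open>w\<close> of the last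
  clause is the first marked parent of \<open>u\<close>.\<close>

definition game_inv :: "'a set \<Rightarrow> 'a set \<Rightarrow> 'a set \<Rightarrow> ('a \<Rightarrow> 'a) \<Rightarrow> bool" where
  "game_inv M A H h \<longleftrightarrow> M \<subseteq> A \<and> A \<subseteq> V \<and> root \<in> M \<and> H \<subseteq> A
     \<and> (\<forall>c\<in>A - {root}. P c \<inter> M \<noteq> {})
     \<and> (\<forall>c\<in>H. h c \<in> P c \<and> h c \<in> A \<and> (\<forall>u\<in>P c - M. r (h c) \<le> r u))
     \<and> (\<forall>w. card {c\<in>H. h c = w} \<le> 2)
     \<and> (\<forall>u. P u \<inter> M \<noteq> {} \<longrightarrow> (\<exists>w\<in>P u \<inter> M. \<forall>c\<in>H. c = u \<or> u \<in> P c \<longrightarrow> h c \<noteq> w))"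

text \<open>Positions after a move of Alice: no activation is pending, as an active vertex has hit
  or is marked with nothing left to hit. Quantifying the bookkeeping away makes this a property of
  the marked set alone.\<close>

definition good :: "'a set \<Rightarrow> bool" where
  "good M \<longleftrightarrow> (\<exists>A H h. game_inv M A H h \<and> (\<forall>w. w \<notin> M \<longrightarrow> card {c\<in>H. h c = w} \<le> 1)
     \<and> (\<forall>c\<in>A. insert c (P c) \<subseteq> M \<or> c \<in> H))"

text \<open>Distinct parents of \<open>c\<close> are adjacent, so a marked parent \<open>a\<close>
  of \<open>c\<close> is a parent or a child of \<open>u\<close>. In the second case
  \<open>a\<close> is active and of smaller rank than \<open>c\<close>, and the induction continues
  with \<open>a\<close>.\<close>

lemma parent_touched:
  assumes "M \<subseteq> A" "\<forall>c\<in>A - {root}. P c \<inter> M \<noteq> {}" "c \<in> A" "u \<in> P c" "u \<notin> M"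
  shows "P u \<inter> M \<noteq> {}"
  using assms(3,4)
proof (induction "r c" arbitrary: c rule: less_induct)
  case less
  then have "c \<noteq> root" using parents_root by auto
  then obtain a where a: "a \<in> P c" "a \<in> M" using assms(2) less.prems by blast
  then have "a \<noteq> u" using assms(5) by auto
  then consider "a \<in> P u" | "u \<in> P a" using clique a less.prems by blast
  then show ?case
  proof cases
    case 1 then show ?thesis using a by auto
  next
    case 2 then show ?thesis using less.hyps[of a] parents[OF a(1)] a assms(1) by auto
  qed
qed

lemma finite_active: "game_inv M A H h \<Longrightarrow> finite H"
  unfolding game_inv_def using finite_V by (meson finite_subset)

lemma game_inv_mark:
  assumes inv: "game_inv M A H h" and y: "y \<in> V" "P y \<inter> M \<noteq> {}"
  shows "game_inv (insert y M) (insert y A) H h"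
proof -
  have MA: "M \<subseteq> A" "A \<subseteq> V" "root \<in> M" "H \<subseteq> A" "\<forall>c\<in>A - {root}. P c \<inter> M \<noteq> {}"
    "\<forall>c\<in>H. h c \<in> P c \<and> h c \<in> A \<and> (\<forall>u\<in>P c - M. r (h c) \<le> r u)"
    "\<forall>w. card {c\<in>H. h c = w} \<le> 2"
    and first: "\<forall>u. P u \<inter> M \<noteq> {} \<longrightarrow> (\<exists>w\<in>P u \<inter> M. \<forall>c\<in>H. c = u \<or> u \<in> P c \<longrightarrow> h c \<noteq> w)"
    using inv unfolding game_inv_def by auto
  have "\<exists>w\<in>P u \<inter> insert y M. \<forall>c\<in>H. c = u \<or> u \<in> P c \<longrightarrow> h c \<noteq> w"
    if u: "P u \<inter> insert y M \<noteq> {}" for u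
  proof (cases "P u \<inter> M = {}")
    \<comment> \<open>By \<open>parent_touched\<close>, neither \<open>u\<close> nor a child of
      \<open>u\<close> has been active so far, so none of them has hit anything and \<open>y\<close>
      itself is the witness.\<close>
    case True
    then have yu: "y \<in> P u" using u by auto
    then have "u \<noteq> root" using parents_root by auto
    then have "u \<notin> A" using True MA by auto
    have "u \<notin> P c" if "c \<in> H" for c
      using parent_touched[OF MA(1,5), of c u] \<open>u \<notin> A\<close> True that MA by auto
    then show ?thesis using yu \<open>u \<notin> A\<close> MA by blast
  next
    case False
    then show ?thesis using first by blast
  qed
  then show ?thesis using MA y unfolding game_inv_def by auto
qed

lemma game_inv_hit:
  assumes inv: "game_inv M A H h" and t: "t \<in> A" "t \<notin> H"
    and w: "w \<in> P t" "w \<notin> M" "\<forall>u\<in>P t - M. r w \<le> r u" "card {c\<in>H. h c = w} \<le> 1"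
  shows "game_inv M (insert w A) (insert t H) (h(t := w))"
proof -
  have MA: "M \<subseteq> A" "A \<subseteq> V" "root \<in> M" "H \<subseteq> A" "\<forall>c\<in>A - {root}. P c \<inter> M \<noteq> {}"
    "\<forall>c\<in>H. h c \<in> P c \<and> h c \<in> A \<and> (\<forall>u\<in>P c - M. r (h c) \<le> r u)"
    "\<forall>w. card {c\<in>H. h c = w} \<le> 2"
    and first: "\<forall>u. P u \<inter> M \<noteq> {} \<longrightarrow> (\<exists>w\<in>P u \<inter> M. \<forall>c\<in>H. c = u \<or> u \<in> P c \<longrightarrow> h c \<noteq> w)"
    using inv unfolding game_inv_def by auto
  have tw: "P w \<inter> M \<noteq> {}" using parent_touched[OF MA(1,5) t(1) w(1,2)] .
  have "{c \<in> insert t H. (h(t := w)) c = v} = (if v = w then insert t {c\<in>H. h c = v} else {c\<in>H. h c = v})"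
    for v using t by auto
  then have card: "card {c \<in> insert t H. (h(t := w)) c = v} \<le> 2" for v
    using MA(7) w(4) finite_active[OF inv] by (auto simp: card_insert_if)
  have "\<exists>x\<in>P u \<inter> M. \<forall>c\<in>insert t H. c = u \<or> u \<in> P c \<longrightarrow> (h(t := w)) c \<noteq> x"
    if u: "P u \<inter> M \<noteq> {}" for u
  proof -
    obtain x where "x \<in> P u \<inter> M" "\<forall>c\<in>H. c = u \<or> u \<in> P c \<longrightarrow> h c \<noteq> x"
      using first u by blast
    \<comment> \<open>The new hit goes to the unmarked \<open>w\<close>, so the marked witness
      \<open>x\<close> stays unhit.\<close>
    then show ?thesis using w(2) by (intro bexI[of _ x]) auto
  qed
  moreover have "w \<in> V" using parents w by blast
  ultimately show ?thesis using MA t w tw card unfolding game_inv_def by auto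
qed

section \<open>Alice's reply\<close>

text \<open>Supplies Alice's move when nothing is pending: an unmarked vertex of least rank.\<close>

lemma exists_unmarked_touched:
  assumes "M \<subseteq> V" "M \<noteq> V" "root \<in> M"
  shows "\<exists>y\<in>V - M. P y \<noteq> {} \<and> P y \<subseteq> M"
proof -
  have "\<exists>y. y \<in> V - M \<and> (\<forall>z. z \<in> V - M \<longrightarrow> r y \<le> r z)"
    using assms ex_has_least_nat[of "\<lambda>x. x \<in> V - M" _ r] by blast
  then obtain y where y: "y \<in> V - M" "\<forall>z. z \<in> V - M \<longrightarrow> r y \<le> r z" by blast
  have "P y \<subseteq> M"
  proof
    fix z assume "z \<in> P y"
    then show "z \<in> M" using parents[of z y] y(2) by force
  qed
  moreover have "P y \<noteq> {}" using y assms(3) no_parents_iff[of y] by auto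
  ultimately show ?thesis using y by auto
qed

text \<open>Only \<open>t\<close> may still be pending. A hit on an inactive vertex passes this role
  to a parent, so the induction runs on the rank of \<open>t\<close>.\<close>

lemma alice_walk:
  assumes "game_inv M A H h" "\<forall>w. w \<notin> M \<longrightarrow> card {c\<in>H. h c = w} \<le> 1"
    "t \<in> A" "\<forall>c\<in>A - {t}. insert c (P c) \<subseteq> M \<or> c \<in> H" "M \<noteq> V"
  shows "\<exists>y\<in>V - M. P y \<inter> M \<noteq> {} \<and> good (insert y M)"
  using assms(1-4)
proof (induction "r t" arbitrary: t A H h rule: less_induct)
  case less
  note inv = less.prems(1) and single = less.prems(2) and tA = less.prems(3) and pend = less.prems(4)
  have MA: "M \<subseteq> A" "A \<subseteq> V" "root \<in> M" "H \<subseteq> A" "\<forall>c\<in>A - {root}. P c \<inter> M \<noteq> {}"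
    "\<forall>c\<in>H. h c \<in> A"
    using inv unfolding game_inv_def by auto
  consider (idle) "t \<in> H \<or> insert t (P t) \<subseteq> M" | (mark) "t \<notin> H" "P t \<subseteq> M" "t \<notin> M"
    | (hit) "t \<notin> H" "\<not> P t \<subseteq> M" by blast
  then show ?case
  proof cases
    case idle
    \<comment> \<open>With all its parents marked, \<open>y\<close> leaves nothing pending once it
      is marked.\<close>
    obtain y where y: "y \<in> V - M" "P y \<noteq> {}" "P y \<subseteq> M"
      using exists_unmarked_touched MA assms(5) by (metis subset_trans)
    have "game_inv (insert y M) (insert y A) H h"
      by (rule game_inv_mark[OF inv]) (use y in auto)
    then have "good (insert y M)" using single pend idle y unfolding good_def
      by (intro exI[of _ "insert y A"] exI[of _ H] exI[of _ h]) auto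
    then show ?thesis using y by blast
  next
    case mark
    then have t: "t \<in> V - M" "P t \<inter> M \<noteq> {}" using MA tA by auto
    then have "game_inv (insert t M) (insert t A) H h"
      by (intro game_inv_mark[OF inv]) auto
    then have "good (insert t M)" using single pend mark unfolding good_def
      by (intro exI[of _ "insert t A"] exI[of _ H] exI[of _ h]) auto
    then show ?thesis using t by blast
  next
    case hit
    have "\<exists>w. w \<in> P t - M \<and> (\<forall>z. z \<in> P t - M \<longrightarrow> r w \<le> r z)"
      using hit ex_has_least_nat[of "\<lambda>x. x \<in> P t - M" _ r] by blast
    then obtain w where w: "w \<in> P t" "w \<notin> M" "\<forall>u\<in>P t - M. r w \<le> r u" by blast
    have tw: "P w \<inter> M \<noteq> {}" using parent_touched[OF MA(1,5) tA w(1,2)] .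
    have wV: "w \<in> V" "r w < r t" using parents w by blast+
    have inv': "game_inv M (insert w A) (insert t H) (h(t := w))"
      using game_inv_hit[OF inv tA hit(1) w] single w by blast
    have "w \<noteq> t" using wV by auto
    have other: "{c \<in> insert t H. (h(t := w)) c = v} = {c\<in>H. h c = v}" if "v \<noteq> w" for v
      using that hit by auto
    show ?thesis
    proof (cases "w \<in> A")
      \<comment> \<open>This may be the second hit on \<open>w\<close>, which is harmless because
        \<open>w\<close> gets marked now. Being active, unmarked and distinct from \<open>t\<close>,
        it has already made its own hit.\<close>
      case True
      have "game_inv (insert w M) (insert w (insert w A)) (insert t H) (h(t := w))"
        by (rule game_inv_mark[OF inv' wV(1) tw])
      moreover have "\<forall>v. v \<notin> insert w M \<longrightarrow> card {c \<in> insert t H. (h(t := w)) c = v} \<le> 1"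
        using other single by (metis insertCI)
      moreover have "\<forall>c\<in>insert w (insert w A). insert c (P c) \<subseteq> insert w M \<or> c \<in> insert t H"
        using pend True by auto
      ultimately have "good (insert w M)" unfolding good_def by blast
      then show ?thesis using wV w tw by blast
    next
      case False
      \<comment> \<open>Earlier hits all lie in \<open>A\<close>, so \<open>t\<close> is the first
        to hit \<open>w\<close>; now \<open>w\<close> is the pending vertex.\<close>
      then have "{c \<in> insert t H. (h(t := w)) c = w} = {t}" using MA by auto
      then have "\<forall>v. v \<notin> M \<longrightarrow> card {c \<in> insert t H. (h(t := w)) c = v} \<le> 1"
        using other single
        by (metis One_nat_def card.empty card.insert empty_iff finite.emptyI order_refl)
      moreover have "\<forall>c\<in>insert w A - {w}. insert c (P c) \<subseteq> M \<or> c \<in> insert t H"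
        using pend by auto
      ultimately show ?thesis using less.hyps[OF wV(2) inv'] by blast
    qed
  qed
qed

lemma good_root: "good {root}"
  unfolding good_def game_inv_def using root_in_V parents_root
  by (intro exI[of _ "{root}"] exI[of _ "{}"]) auto

lemma good_subset: "good M \<Longrightarrow> root \<in> M \<and> M \<subseteq> V"
  unfolding good_def game_inv_def by (elim exE conjE) (meson subset_iff)

text \<open>Turns the legality of Bob's move, adjacency to a marked vertex, into the marked parent
  that \<open>game_inv_mark\<close> asks for. A marked child of \<open>x\<close> is active, so
  \<open>parent_touched\<close> applies.\<close>

lemma good_touched:
  assumes "good M" "x \<in> V - M" "m \<in> M" "x \<in> P m \<or> m \<in> P x"
  shows "P x \<inter> M \<noteq> {}"
proof (cases "m \<in> P x")
  case False
  then have "x \<in> P m" using assms by auto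
  moreover obtain A where "M \<subseteq> A" "\<forall>c\<in>A - {root}. P c \<inter> M \<noteq> {}"
    using assms(1) unfolding good_def game_inv_def by (elim exE conjE) (rule that)
  ultimately show ?thesis using parent_touched[of M A m x] assms by blast
qed (use assms in auto)

text \<open>Bob's vertex becomes active and is the only one that may be pending, so the walk starts
  there.\<close>

lemma alice_reply:
  assumes "good M" "x \<in> V - M" "P x \<inter> M \<noteq> {}" "insert x M \<noteq> V"
  shows "\<exists>y\<in>V - insert x M. P y \<inter> insert x M \<noteq> {} \<and> good (insert y (insert x M))"
proof -
  obtain A H h where *: "game_inv M A H h" "\<forall>w. w \<notin> M \<longrightarrow> card {c\<in>H. h c = w} \<le> 1"
    "\<forall>c\<in>A. insert c (P c) \<subseteq> M \<or> c \<in> H"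
    using assms(1) unfolding good_def by blast
  have "game_inv (insert x M) (insert x A) H h"
    by (rule game_inv_mark[OF *(1)]) (use assms in auto)
  then show ?thesis
    by (rule alice_walk[where t = x]) (use * assms in auto)
qed

section \<open>Counting marked neighbors\<close>

text \<open>As \<open>u\<close> is unmarked, all its active children have hit; they are counted by
  what they hit.\<close>

lemma good_card_children:
  assumes "good M" "u \<in> V - M"
  shows "card {c\<in>M. u \<in> P c} \<le> 2 * (k - 1) \<and> (k = 2 \<longrightarrow> card {c\<in>M. u \<in> P c} \<le> 1)"
proof (cases "{c\<in>M. u \<in> P c} = {}")
  case True
  then show ?thesis by (simp only: card.empty) simp
next
  case False
  obtain A H h where inv: "game_inv M A H h" and single: "\<forall>w. w \<notin> M \<longrightarrow> card {c\<in>H. h c = w} \<le> 1"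
    and pend: "\<forall>c\<in>A. insert c (P c) \<subseteq> M \<or> c \<in> H"
    using assms(1) unfolding good_def by blast
  have MA: "M \<subseteq> A" "A \<subseteq> V" "H \<subseteq> A" "\<forall>c\<in>A - {root}. P c \<inter> M \<noteq> {}"
    and h: "\<forall>c\<in>H. h c \<in> P c \<and> h c \<in> A \<and> (\<forall>u\<in>P c - M. r (h c) \<le> r u)"
    and two: "\<forall>w. card {c\<in>H. h c = w} \<le> 2"
    and first: "\<forall>u. P u \<inter> M \<noteq> {} \<longrightarrow> (\<exists>w\<in>P u \<inter> M. \<forall>c\<in>H. c = u \<or> u \<in> P c \<longrightarrow> h c \<noteq> w)"
    using inv unfolding game_inv_def by auto
  have finA: "finite A" using MA(2) finite_V by (rule finite_subset)
  have finH: "finite H" using finite_active[OF inv] .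
  define C where "C = {c\<in>A. u \<in> P c}"
  \<comment> \<open>An active \<open>u\<close> is counted along with its children: its own hit also
    falls on a parent other than \<open>w0\<close>, which offsets the one hit that \<open>u\<close>
    may have received.\<close>
  define D where "D = C \<union> ({u} \<inter> A)"
  have MC: "card {c\<in>M. u \<in> P c} \<le> card C"
    unfolding C_def using MA finA by (intro card_mono) auto
  have CH: "C \<subseteq> H" and DH: "D \<subseteq> H" using pend assms(2) unfolding C_def D_def by auto
  obtain d where "d \<in> M" "u \<in> P d" using False by auto
  then have "P u \<inter> M \<noteq> {}" using parent_touched[OF MA(1,4)] MA assms by blast
  then obtain w0 where w0: "w0 \<in> P u" "w0 \<in> M" "\<forall>c\<in>H. c = u \<or> u \<in> P c \<longrightarrow> h c \<noteq> w0"
    using first by blast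
  have D_hits: "h c \<in> insert u (P u - {w0})" if "c \<in> D" for c
  proof -
    have c: "c \<in> H" "c = u \<or> u \<in> P c" using that DH unfolding D_def C_def by auto
    then have "h c \<noteq> w0" using w0 by blast
    moreover have "h c = u \<or> h c \<in> P u"
    proof (cases "c = u")
      case False
      \<comment> \<open>\<open>u\<close> is an unmarked parent of \<open>c\<close>, so the vertex
        hit by \<open>c\<close> has rank at most \<open>r u\<close>; by \<open>clique\<close> it is
        \<open>u\<close> or a parent of \<open>u\<close>.\<close>
      then have "u \<in> P c" "h c \<in> P c" "r (h c) \<le> r u" using c h assms(2) by auto
      then show ?thesis using clique parents by (metis not_le)
    qed (use c h in auto)
    ultimately show ?thesis by auto
  qed
  have "card (P u - {w0}) \<le> k - 1"
    using card_parents[of u] w0 finite_parents[of u] by (simp add: card_Diff_singleton)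
  moreover have "card (\<Union>w\<in>P u - {w0}. {c\<in>H. h c = w}) \<le> (\<Sum>w\<in>P u - {w0}. card {c\<in>H. h c = w})"
    by (rule card_UN_le) (use finite_parents in auto)
  moreover have "(\<Sum>w\<in>P u - {w0}. card {c\<in>H. h c = w}) \<le> card (P u - {w0}) * 2"
    using sum_bounded_above[of "P u - {w0}" "\<lambda>w. card {c\<in>H. h c = w}" 2] two by simp
  ultimately have par: "card (\<Union>w\<in>P u - {w0}. {c\<in>H. h c = w}) \<le> 2 * (k - 1)" by linarith
  have "D \<subseteq> {c\<in>H. h c = u} \<union> (\<Union>w\<in>P u - {w0}. {c\<in>H. h c = w})"
    using D_hits DH by auto
  then have "card D \<le> card ({c\<in>H. h c = u} \<union> (\<Union>w\<in>P u - {w0}. {c\<in>H. h c = w}))"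
    using finH finite_parents by (intro card_mono) auto
  also have "\<dots> \<le> card {c\<in>H. h c = u} + card (\<Union>w\<in>P u - {w0}. {c\<in>H. h c = w})"
    by (rule card_Un_le)
  finally have D: "card D \<le> card {c\<in>H. h c = u} + 2 * (k - 1)" using par by linarith
  have "card C \<le> 2 * (k - 1)"
  proof (cases "u \<in> A")
    case True
    have "u \<notin> C" unfolding C_def using parents by auto
    then have "card D = Suc (card C)"
      using True finA unfolding D_def C_def by simp
    moreover have "card {c\<in>H. h c = u} \<le> 1" using single assms by auto
    ultimately show ?thesis using D by linarith
  next
    case False
    then have none: "{c\<in>H. h c = u} = {}" and "D = C" using h unfolding D_def by auto
    then show ?thesis using D unfolding none by simp
  qed
  moreover have "card C \<le> 1" if "k = 2"
  proof -
    have "h c = u" if "c \<in> C" for c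
    proof (rule ccontr)
      assume "h c \<noteq> u"
      have c: "c \<in> H" "u \<in> P c" "c \<in> A" using that CH unfolding C_def by auto
      then have "c \<noteq> root" using parents_root by auto
      then have "P c \<inter> M \<noteq> {}" using c MA by blast
      \<comment> \<open>The last invariant clause, taken at \<open>c\<close> itself, gives a marked
        parent that \<open>c\<close> did not hit. For \<open>k = 2\<close> there is no room for a
        third parent besides \<open>u\<close> and \<open>m\<close>.\<close>
      then obtain m where m: "m \<in> P c" "m \<in> M" "h c \<noteq> m" using first c by blast
      then have "{u, m, h c} \<subseteq> P c" using c h by auto
      then have "card {u, m, h c} \<le> 2"
        using card_mono[OF finite_parents] card_parents[of c] \<open>k = 2\<close> by (meson le_trans)
      moreover have "u \<noteq> m" using m assms by auto
      ultimately show False using \<open>h c \<noteq> u\<close> m by simp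
    qed
    then have "C \<subseteq> {c\<in>H. h c = u}" using CH by auto
    then have "card C \<le> card {c\<in>H. h c = u}" using finH by (intro card_mono) auto
    then show ?thesis using single assms by (meson DiffD2 le_trans)
  qed
  ultimately show ?thesis using MC by (meson le_trans)
qed

text \<open>\<open>M\<close> is the position after Alice's move and \<open>x\<close> is Bob's
  answer, which contributes the extra one. The case \<open>x \<in> M\<close> covers positions where
  Bob has not answered yet.\<close>

lemma card_marked_neighbors_bound:
  assumes "good M" "u \<in> V - insert x M" "k \<ge> 2"
  shows "card {v \<in> insert x M. v \<in> P u \<or> u \<in> P v} < 3 * k"
    and "k = 2 \<Longrightarrow> card {v \<in> insert x M. v \<in> P u \<or> u \<in> P v} < 5"
proof -
  have fin: "finite M" using good_subset[OF assms(1)] finite_V finite_subset by blast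
  have "{v \<in> insert x M. v \<in> P u \<or> u \<in> P v} \<subseteq> P u \<union> insert x {c\<in>M. u \<in> P c}" by auto
  then have "card {v \<in> insert x M. v \<in> P u \<or> u \<in> P v} \<le> card (P u \<union> insert x {c\<in>M. u \<in> P c})"
    using fin finite_parents by (intro card_mono) auto
  also have "\<dots> \<le> card (P u) + card (insert x {c\<in>M. u \<in> P c})" by (rule card_Un_le)
  also have "\<dots> \<le> k + Suc (card {c\<in>M. u \<in> P c})"
    using card_parents[of u] fin by (intro add_mono) (auto simp: card_insert_if)
  finally have b: "card {v \<in> insert x M. v \<in> P u \<or> u \<in> P v} \<le> k + Suc (card {c\<in>M. u \<in> P c})" .
  have "u \<in> V - M" using assms by auto
  note cc = good_card_children[OF assms(1) this]
  show "card {v \<in> insert x M. v \<in> P u \<or> u \<in> P v} < 3 * k" using b cc assms(3) by linarith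
  show "card {v \<in> insert x M. v \<in> P u \<or> u \<in> P v} < 5" if "k = 2" using b cc that by linarith
qed

end

section \<open>Parent orders of k-trees\<close>

text \<open>The initial clique is ordered by a numbering from 0, and each new vertex takes its
  clique \<open>S\<close> as parents. Since \<open>k \<ge> 1\<close>, a root exists and
  \<open>S\<close> is nonempty, so no second parentless vertex appears.\<close>

lemma k_tree_parent_order:
  assumes "k_tree k G" "k \<ge> 1"
  shows "\<exists>P r root. parent_order (pverts G) P r root k \<and> parcs G = {(u, v). u \<in> P v \<or> v \<in> P u}"
  using assms
proof (induction rule: k_tree.induct)
  case (complete G)
  let ?V = "pverts G"
  have G: "finite ?V" "card ?V = k" "parcs G = {(u,v). u \<in> ?V \<and> v \<in> ?V \<and> u \<noteq> v}"
    using complete by (auto simp: complete_digraph_pair_def)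
  obtain f :: "'a \<Rightarrow> nat" where f: "f ` ?V = {..<k}" "inj_on f ?V"
    using ex_bij_betw_finite_nat[OF G(1)] G(2) by (auto simp: bij_betw_def atLeast0LessThan)
  have "0 \<in> f ` ?V" using f complete by auto
  then obtain root where root: "root \<in> ?V" "f root = 0" by auto
  define P where "P v = {u\<in>?V. v \<in> ?V \<and> f u < f v}" for v
  have "parent_order ?V P f root k"
  proof
    show "card (P v) \<le> k" for v
      unfolding P_def using card_mono[OF G(1), of "{u\<in>?V. v \<in> ?V \<and> f u < f v}"] G(2) by auto
    show "v \<in> ?V \<and> P v = {} \<longleftrightarrow> v = root" for v
    proof
      assume v: "v \<in> ?V \<and> P v = {}"
      then have "\<not> f root < f v" unfolding P_def using root by auto
      then show "v = root" using root v inj_onD[OF f(2), of v root] by auto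
    qed (use root in \<open>auto simp: P_def\<close>)
    show "a \<in> P b \<or> b \<in> P a" if "a \<in> P v" "b \<in> P v" "a \<noteq> b" for a b v
      using that inj_onD[OF f(2), of a b] unfolding P_def by (auto simp: not_less_iff_gr_or_eq)
  qed (use G in \<open>auto simp: P_def\<close>)
  moreover have "parcs G = {(u, v). u \<in> P v \<or> v \<in> P u}"
    using f(2) unfolding P_def G(3) by (auto dest: inj_onD simp: not_less_iff_gr_or_eq)
  ultimately show ?case by blast
next
  case (add_vertex G v S)
  then obtain P r root where po: "parent_order (pverts G) P r root k"
    and arcs: "parcs G = {(u, v). u \<in> P v \<or> v \<in> P u}" by blast
  interpret parent_order "pverts G" P r root k by (rule po)
  have S: "card S = k" "arcs_ends (with_proj G \<restriction> S) = {(u,v). u \<in> S \<and> v \<in> S \<and> u \<noteq> v}"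
    using add_vertex.hyps(4) by (auto simp: complete_digraph_def)
  have Sne: "S \<noteq> {}" using S add_vertex by auto
  have S_clique: "(a, b) \<in> parcs G" if "a \<in> S" "b \<in> S" "a \<noteq> b" for a b
  proof -
    have "(a, b) \<in> arcs_ends (with_proj G \<restriction> S)" using S(2) that by auto
    then show ?thesis by (auto simp: arcs_ends_def arc_to_ends_def)
  qed
  let ?V = "insert v (pverts G)"
  let ?P = "P(v := S)"
  \<comment> \<open>The successor of the sum of all ranks exceeds each of them.\<close>
  let ?r = "r(v := Suc (\<Sum>x\<in>pverts G. r x))"
  have r_lt: "?r x < ?r v" if "x \<in> pverts G" for x
    using that member_le_sum[OF that, of r] finite_V add_vertex by (auto simp: less_Suc_eq_le)
  have v_new: "v \<notin> P x" "x \<in> pverts G \<Longrightarrow> x \<noteq> v" "P v = {}" "x \<in> S \<Longrightarrow> x \<noteq> v" for x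
    using parents add_vertex by blast+
  have "parent_order ?V ?P ?r root k"
  proof
    show "finite ?V" using finite_V by simp
    show "u \<in> ?V \<and> w \<in> ?V \<and> ?r u < ?r w" if "u \<in> ?P w" for u w
    proof (cases "w = v")
      case True
      then have "u \<in> pverts G" using that add_vertex by auto
      then show ?thesis using True r_lt by blast
    next
      case False
      then show ?thesis using that parents[of u w] v_new(1)[of w] by auto
    qed
    show "a \<in> ?P b \<or> b \<in> ?P a" if "a \<in> ?P w" "b \<in> ?P w" "a \<noteq> b" for a b w
    proof (cases "w = v")
      case True
      then have "a \<noteq> v" "b \<noteq> v" "(a, b) \<in> parcs G" using that S_clique v_new by auto
      then show ?thesis using arcs by auto
    next
      case False
      then have "a \<noteq> v" "b \<noteq> v" "a \<in> P b \<or> b \<in> P a" using that clique v_new by auto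
      then show ?thesis by auto
    qed
    show "card (?P w) \<le> k" for w using S card_parents by auto
    show "w \<in> ?V \<and> ?P w = {} \<longleftrightarrow> w = root" for w
      using Sne no_parents_iff[of w] root_in_V add_vertex by auto
  qed
  moreover have "parcs G \<union> {v} \<times> S \<union> S \<times> {v} = {(a, b). a \<in> ?P b \<or> b \<in> ?P a}"
    unfolding arcs using v_new by auto
  ultimately show ?case
    unfolding pair_pre_digraph.simps by blast
qed

section \<open>Connected marked sets and legal plays\<close>

text \<open>Connectedness means strong connectedness of the symmetric closure, which excludes the
  empty graph.\<close>

lemma connected_induce_iff:
  "Digraph_Component.connected (with_proj G \<restriction> S) \<longleftrightarrow> S \<noteq> {} \<and>
     (\<forall>u\<in>S. \<forall>v\<in>S. (u, v) \<in> rtrancl_on S {(a, b). a \<in> S \<and> b \<in> S \<and> ((a, b) \<in> parcs G \<or> (b, a) \<in> parcs G)})"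
proof -
  have "arcs_ends (with_proj (mk_symmetric (with_proj G \<restriction> S)))
      = {(a, b). a \<in> S \<and> b \<in> S \<and> ((a, b) \<in> parcs G \<or> (b, a) \<in> parcs G)}"
    by (auto simp: parcs_mk_symmetric)
  then show ?thesis
    by (simp add: Digraph_Component.connected_def strongly_connected_def reachable_def)
qed

lemma connected_induce_singleton: "Digraph_Component.connected (with_proj G \<restriction> {v})"
  by (simp add: connected_induce_iff)

lemma connected_induce_insert:
  assumes "Digraph_Component.connected (with_proj G \<restriction> M)" "u \<in> M" "(u, v) \<in> parcs G"
  shows "Digraph_Component.connected (with_proj G \<restriction> insert v M)"
proof -
  let ?R = "\<lambda>S. {(a, b). a \<in> S \<and> b \<in> S \<and> ((a, b) \<in> parcs G \<or> (b, a) \<in> parcs G)}"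
  have "rtrancl_on M (?R M) \<subseteq> rtrancl_on (insert v M) (?R (insert v M))"
    by (intro subrelI, erule rtrancl_on_mono[rotated 2]) auto
  then have M: "(a, b) \<in> rtrancl_on (insert v M) (?R (insert v M))" if "a \<in> M" "b \<in> M" for a b
    using assms(1) that unfolding connected_induce_iff by blast
  have uv: "(u, v) \<in> rtrancl_on (insert v M) (?R (insert v M))"
    "(v, u) \<in> rtrancl_on (insert v M) (?R (insert v M))"
    using assms(2,3) by (auto intro: rtrancl_on_into_rtrancl_on[OF rtrancl_on_refl])
  have "(a, b) \<in> rtrancl_on (insert v M) (?R (insert v M))" if "a \<in> insert v M" "b \<in> insert v M" for a b
    using that M[of a u] M[of u b] M[of a b] assms(2) uv
    by (elim insertE) (auto intro: rtrancl_on_trans[of _ u])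
  then show ?thesis unfolding connected_induce_iff by blast
qed

lemma connected_induce_insertD:
  assumes "Digraph_Component.connected (with_proj G \<restriction> insert v M)" "v \<notin> M" "M \<noteq> {}"
  shows "\<exists>u\<in>M. (v, u) \<in> parcs G \<or> (u, v) \<in> parcs G"
proof (rule ccontr)
  assume no: "\<not> ?thesis"
  let ?R = "{(a, b). a \<in> insert v M \<and> b \<in> insert v M \<and> ((a, b) \<in> parcs G \<or> (b, a) \<in> parcs G)}"
  obtain m where m: "m \<in> M" using assms by auto
  then have "(v, m) \<in> rtrancl_on (insert v M) ?R"
    using assms(1) unfolding connected_induce_iff by blast
  \<comment> \<open>A walk from \<open>v\<close> never leaves \<open>v\<close>, as no arc joins
    \<open>v\<close> to \<open>M\<close>.\<close>
  then have "m = v"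
    by (induction rule: rtrancl_on_induct) (use no in auto)
  then show False using m assms by auto
qed

lemma legal_play_append1:
  "legal_play G (p @ [x]) \<longleftrightarrow> legal_play G p \<and> legal_move G (set p) x"
  unfolding legal_play_def by (auto simp: less_Suc_eq nth_append)

lemma follows_append1:
  "follows \<sigma> (p @ [x]) \<longleftrightarrow> follows \<sigma> p \<and> (even (length p) \<longrightarrow> x = \<sigma> p)"
  unfolding follows_def by (auto simp: less_Suc_eq nth_append)

lemma legal_play_connected:
  assumes "legal_play G p" "p \<noteq> []"
  shows "Digraph_Component.connected (with_proj G \<restriction> set p)"
  using assms by (cases p rule: rev_cases) (auto simp: legal_play_append1 legal_move_def)

lemma col_cg_le: "alice_strategy G \<sigma> \<Longrightarrow> guarantees G \<sigma> m \<Longrightarrow> col_cg G \<le> m"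
  unfolding col_cg_def by (rule Least_le) blast

section \<open>Alice's strategy and its guarantee\<close>

theorem theorem3p2:
  fixes k :: nat and G :: "'a pair_pre_digraph"
  assumes "k \<ge> 2" and "k_tree k G"
  shows "col_cg G \<le> 3 * k \<and> (k = 2 \<longrightarrow> col_cg G \<le> 5)"
proof -
  obtain P r root where po: "parent_order (pverts G) P r root k"
    and arcs: "parcs G = {(u, v). u \<in> P v \<or> v \<in> P u}"
    using k_tree_parent_order[OF assms(2)] assms(1) by auto
  interpret parent_order "pverts G" P r root k by (rule po)
  have nbrs: "marked_neighbors G M u = {v\<in>M. v \<in> P u \<or> u \<in> P v}" for M u
    unfolding marked_neighbors_def arcs_ends_def by (auto simp: arc_to_ends_def arcs)
  \<comment> \<open>After the root, any legal move that restores \<open>good\<close> will do;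
    \<open>reply\<close> shows that one exists after each move of Bob.\<close>
  define \<sigma> where "\<sigma> p = (if p = [] then root else
    (SOME y. legal_move G (set p) y \<and> good (insert y (set p))))" for p
  have reply: "legal_move G (set p) (\<sigma> p) \<and> good (insert (\<sigma> p) (set p))"
    if p: "legal_play G p" "set p = insert x M" "good M" "x \<in> pverts G - M" "P x \<inter> M \<noteq> {}"
      "set p \<noteq> pverts G" for p x M
  proof -
    obtain y where y: "y \<in> pverts G - set p" "P y \<inter> set p \<noteq> {}" "good (insert y (set p))"
      using alice_reply[OF p(3-5)] p(6) unfolding p(2) by blast
    then obtain z where "z \<in> set p" "(z, y) \<in> parcs G" unfolding arcs by blast
    moreover have "p \<noteq> []" using p(2) by auto
    ultimately have "Digraph_Component.connected (with_proj G \<restriction> insert y (set p))"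
      using connected_induce_insert legal_play_connected[OF p(1)] by metis
    then have "legal_move G (set p) y" unfolding legal_move_def using y by auto
    then have "legal_move G (set p) y \<and> good (insert y (set p))" using y by blast
    from someI[of "\<lambda>y. legal_move G (set p) y \<and> good (insert y (set p))", OF this]
    show ?thesis unfolding \<sigma>_def using \<open>p \<noteq> []\<close> by simp
  qed
  \<comment> \<open>Odd length means that Alice has just moved. At even length, \<open>x\<close> is
    Bob's last vertex and \<open>M\<close> the position before it, the form that
    \<open>reply\<close> needs.\<close>
  have play: "(odd (length p) \<longrightarrow> good (set p)) \<and> (even (length p) \<longrightarrow>
      (\<exists>M x. set p = insert x M \<and> good M \<and> x \<in> pverts G - M \<and> P x \<inter> M \<noteq> {}))"
    if "legal_play G p" "follows \<sigma> p" "p \<noteq> []" for p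
    using that
  proof (induction p rule: rev_induct)
    case (snoc x p)
    then have p: "legal_play G p" "legal_move G (set p) x" "follows \<sigma> p" "even (length p) \<longrightarrow> x = \<sigma> p"
      by (auto simp: legal_play_append1 follows_append1)
    show ?case
    proof (cases "p = []")
      case True
      then show ?thesis using p good_root by (simp add: \<sigma>_def)
    next
      case False
      note IH = snoc.IH[OF p(1,3) False]
      have x: "x \<in> pverts G - set p" using p(2) unfolding legal_move_def by auto
      show ?thesis
      proof (cases "even (length p)")
        case True
        then obtain M z where "set p = insert z M" "good M" "z \<in> pverts G - M" "P z \<inter> M \<noteq> {}"
          using IH by blast
        moreover have "set p \<noteq> pverts G" using x by auto
        ultimately have "good (insert x (set p))" using reply[OF p(1)] p(4) True by blast
        then show ?thesis using True by simp
      next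
        case odd: False
        then have "good (set p)" using IH by blast
        moreover obtain m where "m \<in> set p" "x \<in> P m \<or> m \<in> P x"
          using connected_induce_insertD[of G x "set p"] p(2) False arcs
          unfolding legal_move_def by auto
        ultimately have "P x \<inter> set p \<noteq> {}" using good_touched x by blast
        then show ?thesis using odd \<open>good (set p)\<close> x by auto
      qed
    qed
  qed simp
  have "alice_strategy G \<sigma>"
    unfolding alice_strategy_def
  proof (intro allI impI, elim conjE)
    fix p assume p: "legal_play G p" "follows \<sigma> p" "even (length p)" "set p \<noteq> pverts G"
    show "legal_move G (set p) (\<sigma> p)"
    proof (cases "p = []")
      case True
      then show ?thesis
        by (simp add: \<sigma>_def legal_move_def root_in_V connected_induce_singleton)
    next
      case False
      then show ?thesis using play[OF p(1,2)] reply[OF p(1)] p by blast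
    qed
  qed
  moreover have bound: "card (marked_neighbors G (set p) u) < 3 * k \<and>
      (k = 2 \<longrightarrow> card (marked_neighbors G (set p) u) < 5)"
    if p: "legal_play G p" "follows \<sigma> p" and u: "u \<in> pverts G - set p" for p u
  proof (cases "p = []")
    case True
    then show ?thesis using assms by (simp add: marked_neighbors_def)
  next
    case False
    have "\<exists>M x. set p = insert x M \<and> good M"
    proof (cases "even (length p)")
      case odd: False
      then have "good (set p)" using play[OF p False] by blast
      \<comment> \<open>Reinserting a marked vertex brings positions after Alice's move into the
        form of the bound.\<close>
      moreover have "set p = insert (hd p) (set p)" using False by (simp add: insert_absorb)
      ultimately show ?thesis by blast
    qed (use play[OF p False] in blast)
    then obtain M x where M: "set p = insert x M" "good M" by blast
    then show ?thesis
      using card_marked_neighbors_bound[OF M(2), of u x] u assms(1) unfolding nbrs by auto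
  qed
  ultimately show ?thesis
    using col_cg_le[of G \<sigma>] unfolding guarantees_def by blast
qed

end
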